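(* Let $d,q\ge 1$. Let $G$ be the distribution function of a continuous real random variable whose density function is symmetric about $0$, let $Y$ be a continuous random variable with values in $\mathbb{R}^d$ and density function $f_0$, and let $w:\mathbb{R}^d\to\mathbb{R}$ be a (measurable) function such that $w(Y)$ has a density symmetric about $0$. Suppose that there exists an invertible differentiable transformation $R:\mathbb{R}^d\to\mathbb{R}^d$ such that, for all $y\in\mathbb{R}^d$, $$f_0(y)=f_0[R(y)],\qquad |\det R'(y)|=1,\qquad w[R(y)]=-w(y),$$ where $R'(y)$ denotes the Jacobian matrix of partial derivatives of $R$ at $y$. Let $Z$ be a random variable with density function $2\,f_0(z)\,G\{w(z)\}$, $z\in\mathbb{R}^d$. If $t:\mathbb{R}^d\to\mathbb{R}^q$ is a (measurable) function such that $t(z)=t(R^{-1}(z))$ for all $z\in\mathbb{R}^d$, then $t(Y)$ and $t(Z)$ have the same distribution.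
   Context: A "continuous" random variable is one whose distribution is absolutely continuous with respect to Lebesgue measure, i.e. one that has a density function. A density $g$ on $\mathbb{R}$ is symmetric about $0$ if $g(-x)=g(x)$; then its distribution function $G$ satisfies $G(-x)=1-G(x)$. *)

theory Defs
  imports "HOL-Probability.Probability"
begin

(* The predicate distributed takes ennreal densities, and the function ennreal sends negative
   reals to 0; so nonnegativity is required separately. *)
definition has_density :: "'a measure \<Rightarrow> ('a \<Rightarrow> 'b::euclidean_space) \<Rightarrow> ('b \<Rightarrow> real) \<Rightarrow> bool"
  where "has_density M X f \<longleftrightarrow> (\<forall>x. 0 \<le> f x) \<and> distributed M lborel X (\<lambda>x. ennreal (f x))"

definition has_symmetric_density :: "'a measure \<Rightarrow> ('a \<Rightarrow> real) \<Rightarrow> bool"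
  where "has_symmetric_density M X \<longleftrightarrow> (\<exists>g. has_density M X g \<and> (\<forall>x. g (- x) = g x))"

end

(* Substituting R(z) for z preserves f_0, t and Lebesgue measure and turns G(w) into G(-w) = 1 - G(w).
   Hence the integrals of f_0 G(w) and of f_0 (1 - G(w)) over t^{-1}(B) agree, and twice the first one
   is their sum, the integral of f_0 over t^{-1}(B). *)

theory Submission
  imports Defs
begin

section \<open>Relabelling coordinates: signs, determinants and Lebesgue measure\<close>

text \<open>Since \<open>f\<close> joins two different types, it has no sign of its own and
  multiplicativity of \<open>sign\<close> cannot cancel it. Instead \<open>p\<close> is built up
  from transpositions: conjugation turns the swap of \<open>a\<close> and \<open>b\<close> into the
  swap of \<open>f a\<close> and \<open>f b\<close>, and injectivity makes these two swaps trivial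
  in the same cases.\<close>

lemma sign_conj_bij:
  fixes f :: "'a::finite \<Rightarrow> 'b::finite"
  assumes f: "bij f" and p: "p permutes UNIV"
  shows "sign (f \<circ> p \<circ> inv f) = sign p"
  using p finite_class.finite_UNIV
proof (induction rule: permutes_induct)
  case id
  have "f \<circ> id \<circ> inv f = id"
    using f by (simp add: bij_is_surj surj_iff[symmetric])
  then show ?case by (simp only: sign_id)
next
  case (swap a b p)
  have inj: "f x = f y \<longleftrightarrow> x = y" for x y
    using f by (auto simp: bij_def inj_def)
  have eq: "f \<circ> (Transposition.transpose a b \<circ> p) \<circ> inv f = Transposition.transpose (f a) (f b) \<circ> (f \<circ> p \<circ> inv f)"
    by (auto simp: fun_eq_iff Transposition.transpose_def inj)
  have "bij (f \<circ> p \<circ> inv f)"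
    using f swap.hyps by (intro bij_comp bij_imp_bij_inv) (auto intro: permutes_bij)
  then have "permutation (f \<circ> p \<circ> inv f)"
    by (auto simp: permutation)
  moreover have "permutation p"
    using swap.hyps by (auto simp: permutation intro: permutes_bij)
  ultimately show ?case
    unfolding eq sign_compose[OF permutation_swap_id \<open>permutation (f \<circ> p \<circ> inv f)\<close>]
      sign_compose[OF permutation_swap_id \<open>permutation p\<close>] swap.IH
    by (simp add: sign_swap_id inj)
qed

text \<open>In the Leibniz formula, conjugation by \<open>f\<close> matches the permutations of the
  two index types. It keeps signs, and each product over entries is merely reindexed along
  \<open>f\<close>.\<close>

lemma det_reindex:
  fixes f :: "'m::finite \<Rightarrow> 'n::finite" and A :: "'a::comm_ring_1^'n^'n"
  assumes f: "bij f"
  shows "det (\<chi> i j. A $ f i $ f j) = det A"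
proof -
  have [simp]: "inv f (f x) = x" "f (inv f y) = y" for x y
    using f by (auto simp: bij_is_inj bij_is_surj surj_f_inv_f)
  have bij: "bij_betw (\<lambda>p. f \<circ> p \<circ> inv f) {p. p permutes UNIV} {p. p permutes UNIV}"
  proof (rule bij_betw_byWitness[where f' = "\<lambda>p. inv f \<circ> p \<circ> f"])
    show "(\<lambda>p. f \<circ> p \<circ> inv f) ` {p. p permutes UNIV} \<subseteq> {p. p permutes UNIV}"
      "(\<lambda>p. inv f \<circ> p \<circ> f) ` {p. p permutes UNIV} \<subseteq> {p. p permutes UNIV}"
      using f by (auto intro!: bij_imp_permutes bij_comp bij_imp_bij_inv simp del: comp_apply dest: permutes_bij)
  qed (auto simp: fun_eq_iff)
  have prod: "(\<Prod>j\<in>UNIV. A $ j $ (f \<circ> p \<circ> inv f) j) = (\<Prod>i\<in>UNIV. A $ f i $ f (p i))" for p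
    using prod.reindex_bij_betw[OF f, of "\<lambda>j. A $ j $ (f \<circ> p \<circ> inv f) j"] by simp
  show ?thesis
    unfolding det_def sum.reindex_bij_betw[OF bij, symmetric] prod
    by (intro sum.cong) (auto simp: sign_conj_bij[OF f])
qed

lemma prod_Basis_cart:
  fixes x :: "real^'n"
  shows "(\<Prod>b\<in>Basis. x \<bullet> b) = (\<Prod>i\<in>UNIV. x $ i)"
proof -
  have "bij_betw (\<lambda>i. axis i 1 :: real^'n) UNIV Basis"
    by (auto simp: bij_betw_def inj_on_def axis_eq_axis Basis_vec_def)
  from prod.reindex_bij_betw[OF this, of "\<lambda>b. x \<bullet> b"] show ?thesis
    by (simp add: inner_axis)
qed

lemma measurable_reindex [measurable]:
  fixes f :: "'m::finite \<Rightarrow> 'n::finite"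
  shows "(\<lambda>x::real^'n. \<chi> i. x $ f i) \<in> borel_measurable borel"
  by (intro borel_measurable_continuous_onI continuous_intros)

text \<open>Lebesgue measure is determined by boxes, and the preimage of a box is the box whose
  corners are relabelled by the inverse of \<open>f\<close>. Its side lengths are the same numbers
  in another order.\<close>

lemma lborel_distr_reindex:
  fixes f :: "'m::finite \<Rightarrow> 'n::finite"
  assumes f: "bij f"
  shows "distr lborel borel (\<lambda>x::real^'n. \<chi> i. x $ f i) = lborel"
proof (rule lborel_eqI[symmetric])
  fix l u :: "real^'m"
  assume le: "\<And>b. b \<in> Basis \<Longrightarrow> l \<bullet> b \<le> u \<bullet> b"
  let ?r = "\<lambda>x::real^'m. \<chi> j. x $ inv f j"
  have [simp]: "inv f (f x) = x" "f (inv f y) = y" for x y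
    using f by (auto simp: bij_is_inj bij_is_surj surj_f_inv_f)
  have le': "l $ i \<le> u $ i" for i
    using le[of "axis i 1"] by (simp add: inner_axis)
  have box: "(\<lambda>x. \<chi> i. x $ f i) -` box l u = box (?r l) (?r u)"
    by (auto simp: mem_box_cart)
      (metis \<open>\<And>x. inv f (f x) = x\<close> \<open>\<And>y. f (inv f y) = y\<close>)+
  have "(\<Prod>b\<in>Basis. (?r u - ?r l) \<bullet> b) = (\<Prod>j\<in>UNIV. (u - l) $ inv f j)"
    by (simp add: prod_Basis_cart)
  also have "\<dots> = (\<Prod>b\<in>Basis. (u - l) \<bullet> b)"
    unfolding prod_Basis_cart by (rule prod.reindex_bij_betw[OF bij_imp_bij_inv[OF f]])
  finally have prod: "(\<Prod>b\<in>Basis. (?r u - ?r l) \<bullet> b) = (\<Prod>b\<in>Basis. (u - l) \<bullet> b)" .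
  have "?r l \<bullet> b \<le> ?r u \<bullet> b" if "b \<in> Basis" for b
    using that le' by (auto simp: Basis_vec_def inner_axis)
  then show "emeasure (distr lborel borel (\<lambda>x. \<chi> i. x $ f i)) (box l u) = (\<Prod>b\<in>Basis. (u - l) \<bullet> b)"
    by (simp add: emeasure_distr box emeasure_lborel_box prod[symmetric])
qed simp

section \<open>Bijections with Jacobian determinant of modulus 1 preserve Lebesgue measure\<close>

text \<open>The change of variables theorems of HOL-Analysis require a well-ordered index type.\<close>

typedef 'a wo_copy = "UNIV :: 'a set"
  by simp

instance wo_copy :: (finite) finite
  by intro_classes (simp add: type_definition.univ[OF type_definition_wo_copy])

instantiation wo_copy :: (finite) wellorder
begin

text \<open>The order is pulled back from the naturals along the injection \<open>to_nat\<close>,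
  which exists because finite types are countable; well-foundedness is inherited with it.\<close>

definition less_eq_wo_copy :: "'a wo_copy \<Rightarrow> 'a wo_copy \<Rightarrow> bool"
  where "x \<le> y \<longleftrightarrow> to_nat (Rep_wo_copy x) \<le> to_nat (Rep_wo_copy y)"

definition less_wo_copy :: "'a wo_copy \<Rightarrow> 'a wo_copy \<Rightarrow> bool"
  where "x < y \<longleftrightarrow> to_nat (Rep_wo_copy x) < to_nat (Rep_wo_copy y)"

instance
proof
  fix P :: "'a wo_copy \<Rightarrow> bool" and a
  assume *: "\<And>x. (\<And>y. y < x \<Longrightarrow> P y) \<Longrightarrow> P x"
  show "P a"
    by (induction a rule: measure_induct_rule[of "\<lambda>x. to_nat (Rep_wo_copy x)"])
      (rule *, simp add: less_wo_copy_def)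
qed (auto simp: less_eq_wo_copy_def less_wo_copy_def Rep_wo_copy_inject)

end

lemma bij_Rep_wo_copy: "bij Rep_wo_copy"
  by (rule bijI') (auto simp: Rep_wo_copy_inject intro: Abs_wo_copy_inverse[symmetric])

text \<open>Change of variables is applied on the preimage of a box: the integral of the constant
  Jacobian factor 1 over the preimage is the measure of its image, which is the box itself by
  surjectivity.\<close>

lemma lborel_distr_unimodular_wellorder:
  fixes T :: "real^'n::{finite,wellorder} \<Rightarrow> real^'n::_"
  assumes bij: "bij T" and deriv: "\<And>x. (T has_derivative T' x) (at x)"
    and det: "\<And>x. \<bar>det (matrix (T' x))\<bar> = 1"
  shows "distr lborel borel T = lborel"
proof (rule lborel_eqI[symmetric])
  have "continuous_on UNIV T"
    using deriv by (auto simp: continuous_on_eq_continuous_at intro: has_derivative_continuous)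
  then have T [measurable]: "T \<in> borel_measurable borel"
    by (rule borel_measurable_continuous_onI)
  fix l u :: "real^'n::_"
  assume le: "\<And>b. b \<in> Basis \<Longrightarrow> l \<bullet> b \<le> u \<bullet> b"
  let ?S = "T -` box l u"
  have S: "?S \<in> sets borel"
    using measurable_sets[OF T, of "box l u"] by simp
  have image: "T ` ?S = box l u"
    using bij by (simp add: bij_is_surj surj_image_vimage_eq)
  have "inj_on T ?S"
    using bij by (auto simp: bij_def intro: inj_on_subset)
  from has_measure_differentiable_image[OF _ has_derivative_at_withinI[OF deriv] this,
      of "measure lebesgue (box l u)"]
  have "((\<lambda>x. \<bar>det (matrix (T' x))\<bar>) has_integral measure lebesgue (box l u)) ?S"
    unfolding image using S by simp
  then have "((\<lambda>x. 1) has_integral measure lebesgue (box l u)) ?S"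
    by (simp add: det)
  \<comment> \<open>\<open>measure\<close> is also 0 on sets of infinite measure, so finiteness of
    \<open>?S\<close>, which follows from integrability of 1, has to be recorded before equality of
    \<open>measure\<close> can give equality of \<open>emeasure\<close>.\<close>
  then have "?S \<in> lmeasurable" "integral ?S (\<lambda>x. 1) = measure lebesgue (box l u)"
    by (simp_all add: has_integral_iff lmeasurable_iff_integrable_on)
  then have "?S \<in> lmeasurable" "measure lebesgue ?S = measure lebesgue (box l u)"
    by (simp_all add: lmeasure_integral)
  then have "emeasure lebesgue ?S = emeasure lebesgue (box l u)"
    by (simp add: emeasure_eq_measure2)
  then have "emeasure lborel ?S = emeasure lborel (box l u)"
    using S by simp
  then show "emeasure (distr lborel borel T) (box l u) = (\<Prod>b\<in>Basis. (u - l) \<bullet> b)"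
    using le by (simp add: emeasure_distr)
qed simp

text \<open>The map is transported to the well-ordered copy of the index type as \<open>U\<close>.
  Relabelling changes neither the determinant of the Jacobian nor Lebesgue measure, so the result
  for \<open>U\<close> carries back to \<open>T\<close>.\<close>

lemma lborel_distr_unimodular:
  fixes T :: "real^'n \<Rightarrow> real^'n"
  assumes bij: "bij T" and deriv: "\<And>x. (T has_derivative T' x) (at x)"
    and det: "\<And>x. \<bar>det (matrix (T' x))\<bar> = 1"
  shows "distr lborel borel T = lborel"
proof -
  let ?f = "Rep_wo_copy :: 'n wo_copy \<Rightarrow> 'n"
  define \<phi> where "\<phi> = (\<lambda>x::real^'n. \<chi> i. x $ ?f i)"
  define \<psi> where "\<psi> = (\<lambda>y::real^'n wo_copy. \<chi> j. y $ inv ?f j)"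
  define U where "U = \<phi> \<circ> T \<circ> \<psi>"
  have f: "bij ?f" by (rule bij_Rep_wo_copy)
  have [simp]: "inv ?f (?f x) = x" "?f (inv ?f y) = y" for x y
    using f by (auto simp: bij_is_inj bij_is_surj surj_f_inv_f)
  have inverse [simp]: "\<phi> (\<psi> y) = y" "\<psi> (\<phi> x) = x" for x y
    by (simp_all add: \<phi>_def \<psi>_def vec_eq_iff)
  have "bij \<phi>" "bij \<psi>"
    by (auto intro!: bij_betw_byWitness[where f' = \<psi>] bij_betw_byWitness[where f' = \<phi>])
  then have bij_U: "bij U"
    unfolding U_def using bij by (intro bij_comp)
  have lin: "bounded_linear \<phi>" "bounded_linear \<psi>"
    by (auto simp: linear_conv_bounded_linear[symmetric] \<phi>_def \<psi>_def vec_eq_iff intro!: linearI)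
  have deriv_U: "(U has_derivative (\<lambda>h. \<phi> (T' (\<psi> x) (\<psi> h)))) (at x)" for x
  proof -
    have "(T \<circ> \<psi> has_derivative T' (\<psi> x) \<circ> \<psi>) (at x)"
      by (intro diff_chain_at deriv bounded_linear_imp_has_derivative lin)
    from bounded_linear.has_derivative[OF lin(1) this] show ?thesis
      by (simp add: U_def o_def)
  qed
  \<comment> \<open>Unit vectors go to unit vectors, so the columns of the Jacobian of
    \<open>U\<close> are relabelled columns of that of \<open>T\<close>; \<open>\<phi>\<close>
    relabels the rows.\<close>
  have axis: "\<psi> (axis j 1) = axis (?f j) 1" for j
    by (auto simp: \<psi>_def axis_def vec_eq_iff)
  have mat: "matrix (\<lambda>h. \<phi> (T' x (\<psi> h))) = (\<chi> i j. matrix (T' x) $ ?f i $ ?f j)" for x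
    unfolding matrix_def by (simp add: axis \<phi>_def vec_eq_iff)
  have "\<bar>det (matrix (\<lambda>h. \<phi> (T' x (\<psi> h))))\<bar> = 1" for x
    unfolding mat det_reindex[OF f] by (rule det)
  from lborel_distr_unimodular_wellorder[OF bij_U deriv_U this]
  have U: "distr lborel borel U = lborel" .
  have cont: "continuous_on UNIV U"
    using deriv_U by (auto simp: continuous_on_eq_continuous_at intro: has_derivative_continuous)
  have [measurable]: "\<phi> \<in> borel_measurable borel" "\<psi> \<in> borel_measurable borel"
      "U \<in> borel_measurable borel"
    unfolding \<phi>_def \<psi>_def using cont by (auto intro: borel_measurable_continuous_onI)
  have "distr lborel borel T = distr lborel borel (\<psi> \<circ> U \<circ> \<phi>)"
    by (simp add: U_def o_def)
  also have "\<dots> = distr (distr (distr lborel borel \<phi>) borel U) borel \<psi>"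
    by (simp add: distr_distr o_assoc)
  also have "\<dots> = lborel"
    unfolding \<phi>_def lborel_distr_reindex[OF f] U
    unfolding \<psi>_def by (rule lborel_distr_reindex[OF bij_imp_bij_inv[OF f]])
  finally show ?thesis .
qed

section \<open>The distribution function of a symmetric density\<close>

lemma cdf_symmetric_density:
  assumes "prob_space M" and "has_symmetric_density M X"
  shows "cdf (distr M borel X) (- x) = 1 - cdf (distr M borel X) x"
proof -
  interpret prob_space M by fact
  obtain g where g: "\<And>x. g (- x) = g x" and D: "distributed M lborel X (\<lambda>x. ennreal (g x))"
    using assms(2) by (auto simp: has_symmetric_density_def has_density_def)
  have [measurable]: "X \<in> borel_measurable M" "(\<lambda>x. ennreal (g x)) \<in> borel_measurable borel"
    using D by (auto simp: distributed_def)
  let ?N = "distr M borel X"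
  interpret N: prob_space ?N by (rule prob_space_distr) measurable
  have N: "?N = density lborel (\<lambda>x. ennreal (g x))"
    using D by (simp add: distributed_def cong: distr_cong)
  \<comment> \<open>Lebesgue measure is written as its own image under negation, so that the
    substitution of -y for y becomes an instance of \<open>nn_integral_distr\<close>.\<close>
  have "emeasure ?N {..- x} = (\<integral>\<^sup>+y. ennreal (g y) * indicator {..- x} y \<partial>distr lborel borel uminus)"
    unfolding N lborel_distr_uminus by (subst emeasure_density) auto
  also have "\<dots> = (\<integral>\<^sup>+y. ennreal (g y) * indicator {x..} y \<partial>lborel)"
    by (subst nn_integral_distr) (auto simp: g indicator_def intro!: nn_integral_cong)
  also have "\<dots> = emeasure ?N {x..}"
    unfolding N by (subst emeasure_density) auto
  finally have 1: "measure ?N {..- x} = measure ?N {x..}"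
    by (simp add: measure_def)
  \<comment> \<open>Reflection yields the closed ray from x upwards, whereas the complement of the
    event counted by \<open>cdf\<close> is the open one. They differ by a single point, which has no
    mass under a density.\<close>
  have "emeasure ?N {x} = 0"
    unfolding N by (subst emeasure_density) (auto simp: nn_integral_0_iff_AE intro!: AE_I[of _ _ "{x}"])
  then have "measure ?N {x} = 0"
    by (simp add: measure_def)
  moreover have "measure ?N {x..} = measure ?N {x} + measure ?N {x<..}"
    by (subst N.finite_measure_Union[symmetric]) (auto intro!: arg_cong[where f = "measure ?N"])
  moreover have "measure ?N {x<..} = 1 - measure ?N {..x}"
    using N.prob_compl[of "{..x}"] by (simp add: Compl_eq_Diff_UNIV[symmetric])
  ultimately show ?thesis
    using 1 by (simp add: cdf_def)
qed

section \<open>Equality of the distributions of t(Y) and t(Z)\<close>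

theorem mainTheorem2:
  fixes MX :: "'x measure" and X :: "'x \<Rightarrow> real" and G :: "real \<Rightarrow> real"
    and MY :: "'y measure" and Y :: "'y \<Rightarrow> real^'d" and f0 :: "real^'d \<Rightarrow> real"
    and MZ :: "'z measure" and Z :: "'z \<Rightarrow> real^'d"
    and w :: "real^'d \<Rightarrow> real" and R :: "real^'d \<Rightarrow> real^'d" and t :: "real^'d \<Rightarrow> real^'q"
  assumes "prob_space MX" and "prob_space MY" and "prob_space MZ"
    and "has_symmetric_density MX X" and "G = cdf (distr MX borel X)"
    and "has_density MY Y f0"
    and "w \<in> borel_measurable borel" and "has_symmetric_density MY (\<lambda>\<omega>. w (Y \<omega>))"
    and "bij R" and "\<And>y. R differentiable (at y)"
    and "\<And>y. f0 y = f0 (R y)"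
    and "\<And>y. \<bar>det (jacobian R (at y))\<bar> = 1"
    and "\<And>y. w (R y) = - w y"
    and "has_density MZ Z (\<lambda>z. 2 * f0 z * G (w z))"
    and "t \<in> borel_measurable borel" and "\<And>z. t z = t (inv R z)"
  shows "distr MY borel (\<lambda>\<omega>. t (Y \<omega>)) = distr MZ borel (\<lambda>\<omega>. t (Z \<omega>))"
proof (rule measure_eqI)
  note [measurable] = assms(7,15)
  have "continuous_on UNIV R"
    using assms(10) by (auto simp: continuous_on_eq_continuous_at intro: differentiable_imp_continuous_within)
  then have [measurable]: "R \<in> borel_measurable borel"
    by (rule borel_measurable_continuous_onI)
  \<comment> \<open>\<open>jacobian\<close> is the matrix of the chosen Frechet derivative, and
    differentiability ensures that this choice is indeed a derivative.\<close>
  have R: "distr lborel borel R = lborel"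
    using assms(10,12) unfolding jacobian_def frechet_derivative_works
    by (intro lborel_distr_unimodular[OF assms(9)])
  have G0: "0 \<le> G x" for x
    by (simp add: assms(5) cdf_def)
  have G_minus: "G (- x) = 1 - G x" for x
    unfolding assms(5) by (rule cdf_symmetric_density) fact+
  have f0: "0 \<le> f0 x" for x
    using assms(6) by (simp add: has_density_def)
  have [measurable]: "Y \<in> borel_measurable MY" "(\<lambda>x. ennreal (f0 x)) \<in> borel_measurable borel"
    and Y: "distr MY borel Y = density lborel (\<lambda>x. ennreal (f0 x))"
    using assms(6) by (auto simp: has_density_def distributed_def cong: distr_cong)
  have [measurable]: "Z \<in> borel_measurable MZ"
      "(\<lambda>x. ennreal (2 * f0 x * G (w x))) \<in> borel_measurable borel"
    and Z: "distr MZ borel Z = density lborel (\<lambda>z. ennreal (2 * f0 z * G (w z)))"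
    using assms(14) by (auto simp: has_density_def distributed_def cong: distr_cong)
  have t: "t (R z) = t z" for z
    using assms(16)[of "R z"] assms(9) by (simp add: bij_is_inj)
  fix B assume "B \<in> sets (distr MY borel (\<lambda>\<omega>. t (Y \<omega>)))"
  then have [measurable]: "B \<in> sets borel" by simp
  have B: "t -` B \<in> sets borel"
    using measurable_sets[OF assms(15), of B] by simp
  note this [measurable]
  \<comment> \<open>Measurability is read off from the density of \<open>Z\<close> by halving it in
    the extended nonnegative reals.\<close>
  have [measurable]: "(\<lambda>x. ennreal (f0 x * G (w x))) \<in> borel_measurable borel"
  proof -
    have "(\<lambda>x. ennreal (2 * f0 x * G (w x)) / 2) \<in> borel_measurable borel"
      by measurable
    moreover have "ennreal (2 * f0 x * G (w x)) / 2 = ennreal (f0 x * G (w x))" for x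
      using divide_ennreal[of "2 * f0 x * G (w x)" 2] f0 G0 by simp
    ultimately show ?thesis by simp
  qed
  let ?h = "\<lambda>z. ennreal (f0 z * G (w z)) * indicator (t -` B) z"
  \<comment> \<open>The substitution of R(z) for z, justified by invariance of Lebesgue measure
    under \<open>R\<close>.\<close>
  have "(\<integral>\<^sup>+z. ?h z \<partial>lborel) = (\<integral>\<^sup>+z. ?h z \<partial>distr lborel borel R)"
    by (simp add: R)
  also have "\<dots> = (\<integral>\<^sup>+z. ?h (R z) \<partial>lborel)"
    by (rule nn_integral_distr) measurable
  finally have h: "(\<integral>\<^sup>+z. ?h z \<partial>lborel) = (\<integral>\<^sup>+z. ?h (R z) \<partial>lborel)" .
  \<comment> \<open>Pointwise splitting: the weights G(w(z)) and G(w(R(z))) = G(-w(z)) add up to 1,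
    while \<open>f0\<close> and membership in the preimage of \<open>B\<close> are unchanged by
    \<open>R\<close>. Nonnegativity of both summands lets \<open>ennreal\<close> distribute over the
    sum.\<close>
  have "ennreal (f0 z) * indicator (t -` B) z = ?h z + ?h (R z)" for z
  proof -
    have "f0 z = f0 z * G (w z) + f0 (R z) * G (w (R z))"
      by (simp add: assms(11)[symmetric] assms(13) G_minus algebra_simps)
    then have "ennreal (f0 z) = ennreal (f0 z * G (w z)) + ennreal (f0 (R z) * G (w (R z)))"
      using f0 G0 by (metis ennreal_plus mult_nonneg_nonneg)
    then show ?thesis
      by (simp add: t indicator_def)
  qed
  then have "(\<integral>\<^sup>+z. ennreal (f0 z) * indicator (t -` B) z \<partial>lborel) = (\<integral>\<^sup>+z. ?h z + ?h (R z) \<partial>lborel)"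
    by simp
  also have "\<dots> = (\<integral>\<^sup>+z. ?h z \<partial>lborel) + (\<integral>\<^sup>+z. ?h (R z) \<partial>lborel)"
    by (rule nn_integral_add) measurable
  \<comment> \<open>Replacing the substituted integral by the original one produces the factor 2 in
    the density of \<open>Z\<close>.\<close>
  also have "\<dots> = (\<integral>\<^sup>+z. ?h z + ?h z \<partial>lborel)"
    unfolding h[symmetric] by (rule nn_integral_add[symmetric]) measurable
  also have "\<dots> = (\<integral>\<^sup>+z. ennreal (2 * f0 z * G (w z)) * indicator (t -` B) z \<partial>lborel)"
    using f0 G0 by (intro nn_integral_cong) (auto simp: indicator_def ennreal_plus[symmetric] simp del: ennreal_plus)
  finally have eq: "emeasure (distr MY borel Y) (t -` B) = emeasure (distr MZ borel Z) (t -` B)"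
    unfolding Y Z using B by (simp add: emeasure_density)
  have "emeasure (distr MY borel (\<lambda>\<omega>. t (Y \<omega>))) B = emeasure (distr MY borel Y) (t -` B)"
    using B by (subst (1 2) emeasure_distr) (auto simp: vimage_def)
  moreover have "emeasure (distr MZ borel (\<lambda>\<omega>. t (Z \<omega>))) B = emeasure (distr MZ borel Z) (t -` B)"
    using B by (subst (1 2) emeasure_distr) (auto simp: vimage_def)
  ultimately show "emeasure (distr MY borel (\<lambda>\<omega>. t (Y \<omega>))) B = emeasure (distr MZ borel (\<lambda>\<omega>. t (Z \<omega>))) B"
    using eq by simp
qed simp

end
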